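(* Let $g \notin \{-1,1\}$ be an odd integer and let $w$ be a non-zero integer. Then $$\sum_{k=1}^{\omega_g(2^n)} e^{2\pi i w g^k/2^n} = 0$$ for every integer $n \ge d(w) + \max\{3, c(g)\}$.
   Context: For an odd integer $g$ and a positive integer $m$, $\omega_g(2^m)=\min\{k\in\mathbb{N} : g^k \equiv 1 \pmod{2^m}\}$ is the multiplicative order of $g$ modulo $2^m$ ($\mathbb{N}=\{1,2,\dots\}$). For a non-zero integer $w$, $d(w)=\max\{k \in \mathbb{N}_0 : 2^k \mid w\}$ is the exponent of the largest power of $2$ dividing $w$. For an odd integer $g \notin\{-1,1\}$, $c(g)=\min\{k\in\mathbb{N} : g < 2^{k-1}-1\}$ if $g>1$, and $c(g)=\min\{k\in\mathbb{N} : g > -2^{k-1}-1\}$ if $g<-1$. *)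

theory Defs
  imports Complex_Main "HOL-Number_Theory.Number_Theory"
begin

text \<open>The case distinction is meant for odd \<open>g\<close> with \<open>g > 1\<close> or \<open>g < -1\<close>; the values at
  \<open>-1\<close>, \<open>0\<close> and \<open>1\<close> are irrelevant. Since \<open>k \<ge> 1\<close>, the exponent \<open>k - 1\<close> is never truncated.\<close>

definition c_bound :: "int \<Rightarrow> nat" where
  "c_bound g =
     (if g > 1 then (LEAST k. 1 \<le> k \<and> g < 2 ^ (k - 1) - 1)
      else (LEAST k. 1 \<le> k \<and> g > - (2 ^ (k - 1)) - 1))"

end

theory Submission
  imports Defs "HOL-Analysis.Complex_Transcendental"
begin

text \<open>Put \<open>d = multiplicity 2 w\<close> and \<open>m = n - d\<close>. The bound \<open>m \<ge> max 3 (c_bound g)\<close> forces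
  some power \<open>g ^ j\<close> to be congruent to \<open>1 + 2 ^ (m - 1)\<close> modulo \<open>2 ^ m\<close>: either \<open>g\<close>
  itself is, or \<open>g\<^sup>2 - 1\<close> is a nonzero residue modulo \<open>2 ^ m\<close> divisible by 4, and each further
  squaring raises its 2-adic valuation by exactly one. Shifting the summation index by \<open>j\<close>
  negates every term, but leaves the sum over a full period unchanged.\<close>

lemma sum_periodic_shift:
  fixes f :: "nat \<Rightarrow> 'a :: ab_group_add"
  assumes "\<And>k. f (k + p) = f k"
  shows "(\<Sum>k = 1..p. f (k + j)) = (\<Sum>k = 1..p. f k)"
proof (induction j)
  case (Suc j)
  have "(\<Sum>k = 1..p. f (k + Suc j)) = (\<Sum>k = Suc 1..Suc p. f (k + j))"
    by (subst sum.shift_bounds_cl_Suc_ivl) simp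
  \<comment> \<open>Moving the window by one drops \<open>f (1 + j)\<close> and gains
    \<open>f (Suc p + j)\<close>; periodicity makes them equal.\<close>
  also have "\<dots> = (\<Sum>k = 1..Suc p. f (k + j)) - f (1 + j)"
    by (subst sum.atLeast_Suc_atMost [of 1 "Suc p"]) auto
  also have "\<dots> = (\<Sum>k = 1..p. f (k + j))"
    using assms [of "1 + j"] by (simp add: ac_simps)
  finally show ?case using Suc by simp
qed simp

text \<open>Squaring 1 + 2^r q gives 1 + 2^(r+1) q (1 + 2^(r-1) q), and the new cofactor stays odd
  because r \<ge> 2.\<close>

lemma power_power2_minus_one_valuation:
  fixes x q :: int
  assumes "x = 1 + 2 ^ r * q" and "odd q" and "r \<ge> 2"
  shows "\<exists>q'. odd q' \<and> x ^ 2 ^ i = 1 + 2 ^ (r + i) * q'"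
proof (induction i)
  case 0
  show ?case using assms by auto
next
  case (Suc i)
  then obtain q' where q': "odd q'" "x ^ 2 ^ i = 1 + 2 ^ (r + i) * q'" by blast
  obtain t where t: "r + i = Suc (Suc t)"
    using assms(3) by (metis add_2_eq_Suc le_add1 le_iff_add le_trans)
  have "x ^ 2 ^ Suc i = (x ^ 2 ^ i)\<^sup>2"
    by (simp only: power_Suc2 power_mult)
  also have "\<dots> = 1 + 2 ^ (r + Suc i) * (q' * (1 + 2 ^ Suc t * q'))"
    unfolding q'(2) add_Suc_right t by (simp add: algebra_simps power2_eq_square)
  finally show ?case
    using q'(1) by (intro exI [of _ "q' * (1 + 2 ^ Suc t * q')"]) simp
qed

text \<open>With g = 2a + 1 we get g^2 - 1 = 4a(a + 1). Only one of a and a + 1 is even, so it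
  absorbs the whole factor 2^(m-2).\<close>

lemma two_power_dvd_square_minus_one:
  fixes g :: int
  assumes "odd g" and "2 ^ m dvd g\<^sup>2 - 1" and "m \<ge> 2"
  shows "2 ^ (m - 1) dvd g - 1 \<or> 2 ^ (m - 1) dvd g + 1"
proof -
  obtain a where a: "g = 2 * a + 1" using assms(1) by (elim oddE)
  obtain t where t: "m = Suc (Suc t)"
    using assms(3) by (metis add_2_eq_Suc le_iff_add)
  have "g\<^sup>2 - 1 = 4 * (a * (a + 1))"
    by (simp add: a power2_eq_square algebra_simps)
  with assms(2) have "4 * 2 ^ t dvd 4 * (a * (a + 1))" by (simp add: t)
  hence dvd: "2 ^ t dvd a * (a + 1)" by simp
  have "2 ^ t dvd a \<or> 2 ^ t dvd a + 1"
  proof (cases "even a")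
    case True
    hence "coprime (2 ^ t) (a + 1)" by simp
    thus ?thesis using dvd by (simp add: coprime_dvd_mult_left_iff)
  next
    case False
    hence "coprime (2 ^ t) a" by simp
    thus ?thesis using dvd by (simp add: coprime_dvd_mult_right_iff)
  qed
  hence "2 * 2 ^ t dvd 2 * a \<or> 2 * 2 ^ t dvd 2 * (a + 1)"
    using mult_dvd_mono [OF dvd_refl] by blast
  thus ?thesis by (simp add: a t algebra_simps)
qed

lemma ex_power_eq_one_plus_half:
  fixes g :: int
  assumes "odd g" and "\<not> 2 ^ m dvd g\<^sup>2 - 1"
  shows "\<exists>j q. odd q \<and> g ^ j = 1 + 2 ^ (m - 1) * q"
proof -
  have nz: "g\<^sup>2 - 1 \<noteq> 0" using assms(2) by (metis dvd_0_right)
  define s where "s = multiplicity 2 (g\<^sup>2 - 1)"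
  obtain q where q: "g\<^sup>2 - 1 = 2 ^ s * q" "odd q"
    unfolding s_def using multiplicity_decompose' [OF nz, of 2] by auto
  \<comment> \<open>This is why the squarings start from g^2: g - 1 itself may have valuation 1,
    where the squaring lemma fails.\<close>
  have "4 dvd g\<^sup>2 - 1"
  proof -
    obtain a where "g = 2 * a + 1" using assms(1) by (elim oddE)
    hence "g\<^sup>2 - 1 = 4 * (a * (a + 1))"
      by (simp add: power2_eq_square algebra_simps)
    thus ?thesis by simp
  qed
  hence "2\<^sup>2 dvd g\<^sup>2 - 1" by simp
  hence "s \<ge> 2"
    unfolding s_def using nz by (intro multiplicity_geI) auto
  moreover have "s < m"
    using assms(2) q(1) by (metis dvd_triv_left le_imp_power_dvd not_le dvd_mult2)
  moreover have "g\<^sup>2 = 1 + 2 ^ s * q" using q(1) by simp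
  \<comment> \<open>Starting at valuation s < m, exactly m - 1 - s squarings reach m - 1.\<close>
  ultimately obtain q' where "odd q'" "(g\<^sup>2) ^ 2 ^ (m - 1 - s) = 1 + 2 ^ (s + (m - 1 - s)) * q'"
    using power_power2_minus_one_valuation q(2) by blast
  hence "g ^ (2 * 2 ^ (m - 1 - s)) = 1 + 2 ^ (m - 1) * q'"
    using \<open>s < m\<close> by (simp add: power_mult)
  thus ?thesis using \<open>odd q'\<close> by blast
qed

lemma
  assumes "m \<ge> c_bound g"
  shows c_bound_pos: "g > 1 \<Longrightarrow> g < 2 ^ (m - 1) - 1"
    and c_bound_neg: "g < 1 \<Longrightarrow> g > - (2 ^ (m - 1)) - 1"
proof -
  have mono: "(2 :: int) ^ (c_bound g - 1) \<le> 2 ^ (m - 1)"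
    using assms by (intro power_increasing) auto
  have lt: "\<bar>g\<bar> < 2 ^ nat \<bar>g\<bar>"
    using of_nat_less_two_power [of "nat \<bar>g\<bar>", where 'a = int] by simp
  {
    assume g: "g > 1"
    \<comment> \<open>An explicit witness, so that the minimum defining \<open>c_bound\<close> is
      attained.\<close>
    have "g < 2 ^ (Suc (Suc (nat \<bar>g\<bar>)) - 1) - 1"
      using lt g by simp
    hence "1 \<le> c_bound g \<and> g < 2 ^ (c_bound g - 1) - 1"
      unfolding c_bound_def if_P [OF g]
      by (rule LeastI [where P = "\<lambda>k. 1 \<le> k \<and> g < 2 ^ (k - 1) - 1", OF conjI, rotated]) simp
    thus "g < 2 ^ (m - 1) - 1" using mono by linarith
  next
    assume g: "g < 1"
    have "g > - (2 ^ (Suc (nat \<bar>g\<bar>) - 1)) - 1"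
      using lt g by simp
    hence "1 \<le> c_bound g \<and> g > - (2 ^ (c_bound g - 1)) - 1"
      unfolding c_bound_def if_not_P [OF less_not_sym [OF g]]
      by (rule LeastI [where P = "\<lambda>k. 1 \<le> k \<and> g > - (2 ^ (k - 1)) - 1", OF conjI, rotated]) simp
    thus "g > - (2 ^ (m - 1)) - 1" using mono by linarith
  }
qed

text \<open>If 2^m divides g^2 - 1, then g is \<plusminus>1 modulo 2^(m-1). The size bound rules out
  every such g except 1 - 2^(m-1), for which j = 1 works.\<close>

lemma ex_power_eq_one_plus_half_of_c_bound:
  assumes "odd g" and "g \<notin> {-1, 1}" and "m \<ge> 2" and "m \<ge> c_bound g"
  shows "\<exists>j q. odd q \<and> g ^ j = 1 + 2 ^ (m - 1) * q"
proof (cases "2 ^ m dvd g\<^sup>2 - 1")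
  case False
  thus ?thesis using ex_power_eq_one_plus_half assms(1) by blast
next
  case True
  have "g \<noteq> 0" using assms(1) by auto
  consider "2 ^ (m - 1) dvd g - 1" | "2 ^ (m - 1) dvd g + 1"
    using two_power_dvd_square_minus_one [OF assms(1) True assms(3)] by blast
  hence "g < 1 \<and> 2 ^ (m - 1) dvd g - 1"
  proof cases
    case 1
    have "\<not> g > 1"
      using zdvd_imp_le [OF 1] c_bound_pos [OF assms(4)] by auto
    thus ?thesis using 1 assms(2) by auto
  next
    case 2
    have "\<not> g > 1"
      using zdvd_imp_le [OF 2] c_bound_pos [OF assms(4)] by auto
    hence g: "g < -1" using assms(2) \<open>g \<noteq> 0\<close> by auto
    have "2 ^ (m - 1) dvd - (g + 1)" using 2 by (simp only: dvd_minus_iff)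
    hence "2 ^ (m - 1) \<le> - (g + 1)" using g by (intro zdvd_imp_le) auto
    thus ?thesis using c_bound_neg [OF assms(4)] g by linarith
  qed
  hence g: "g < 1" "2 ^ (m - 1) dvd 1 - g"
    by (auto simp: dvd_diff_commute)
  \<comment> \<open>The bounds leave g = 1 - 2^(m-1) or g = -2^(m-1); parity excludes the
    latter.\<close>
  have ev: "even ((2 :: int) ^ (m - 1))" using assms(3) by simp
  have "2 ^ (m - 1) \<le> 1 - g" using g by (intro zdvd_imp_le) auto
  moreover have "g > - (2 ^ (m - 1)) - 1" using c_bound_neg [OF assms(4)] g by simp
  moreover have "g \<noteq> - (2 ^ (m - 1))" using ev assms(1) by (metis dvd_minus_iff)
  ultimately have "g ^ 1 = 1 + 2 ^ (m - 1) * (-1)" by simp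
  thus ?thesis by (metis odd_one dvd_minus_iff)
qed

lemma cong_power_ord_int:
  fixes a m :: int
  assumes "coprime m a" and "m > 0"
  shows "[a ^ ord m a = 1] (mod m)"
proof -
  have "\<exists>k>0. [a ^ k = 1] (mod m)"
  \<comment> \<open>The locale \<open>residues\<close> requires a modulus above 1.\<close>
  proof (cases "m = 1")
    case False
    hence "residues m" using assms(2) by (simp add: residues_def)
    moreover have "coprime a m" using assms(1) by (simp add: ac_simps)
    ultimately have "[a ^ totient (nat m) = 1] (mod m)"
      by (rule residues.euler_theorem)
    moreover have "totient (nat m) > 0" using assms(2) by simp
    ultimately show ?thesis by blast
  qed auto
  thus ?thesis
    unfolding ord_def if_P [OF assms(1)] by (rule LeastI2_ex) blast
qed

lemma exp_two_power_cong:
  fixes a b :: int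
  assumes "[a = b] (mod 2 ^ n)"
  shows "exp (2 * of_real pi * \<i> * of_int a / 2 ^ n) = (exp (2 * of_real pi * \<i> * of_int b / 2 ^ n) :: complex)"
proof -
  obtain t where "a = b + 2 ^ n * t"
    using assms by (metis cong_iff_lin cong_sym)
  hence "2 * of_real pi * \<i> * of_int a / 2 ^ n =
      2 * of_real pi * \<i> * of_int b / 2 ^ n + of_int (2 * t) * (of_real pi * \<i> :: complex)"
    by (simp add: field_simps)
  thus ?thesis by (subst exp_eq) auto
qed

text \<open>The two arguments differ by q \<pi> i, an odd number of half turns.\<close>

lemma exp_two_power_half:
  fixes a b q :: int
  assumes "a = b + 2 ^ (n - 1) * q" and "odd q" and "n \<ge> 1"
  shows "exp (2 * of_real pi * \<i> * of_int a / 2 ^ n) = - (exp (2 * of_real pi * \<i> * of_int b / 2 ^ n) :: complex)"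
proof -
  obtain t where t: "q = 2 * t + 1" using assms(2) by (elim oddE)
  obtain n' where n': "n = Suc n'" using assms(3) by (cases n) auto
  have "2 * of_real pi * \<i> * of_int a / 2 ^ n =
      (2 * of_real pi * \<i> * of_int b / 2 ^ n + of_real pi * \<i>) + of_int (2 * t) * (of_real pi * \<i> :: complex)"
    by (simp add: assms(1) t n' field_simps)
  hence "exp (2 * of_real pi * \<i> * of_int a / 2 ^ n) =
      (exp (2 * of_real pi * \<i> * of_int b / 2 ^ n + of_real pi * \<i>) :: complex)"
    by (subst exp_eq) auto
  thus ?thesis by (simp add: exp_add)
qed

theorem theorem6:
  fixes g w :: int and n :: nat
  assumes "odd g" and "g \<notin> {-1, 1}" and "w \<noteq> 0"
    and "n \<ge> multiplicity 2 w + max 3 (c_bound g)"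
  shows "(\<Sum>k = 1..ord (2 ^ n) g.
           exp (2 * of_real pi * \<i> * of_int w * of_int g ^ k / 2 ^ n)) = (0 :: complex)"
proof -
  define d where "d = multiplicity 2 w"
  obtain w' where w': "w = 2 ^ d * w'" "odd w'"
    unfolding d_def using multiplicity_decompose' [OF assms(3), of 2] by auto
  define m where "m = n - d"
  have m: "m \<ge> 3" "m \<ge> c_bound g" "n = d + m"
    using assms(4) by (auto simp: m_def d_def)
  obtain j q where j: "odd q" "g ^ j = 1 + 2 ^ (m - 1) * q"
    using ex_power_eq_one_plus_half_of_c_bound [OF assms(1,2) _ m(2)] m(1) by auto
  define f :: "nat \<Rightarrow> complex"
    where "f k = exp (2 * of_real pi * \<i> * of_int (w * g ^ k) / 2 ^ n)" for k
  define S where "S = (\<Sum>k = 1..ord (2 ^ n) g. f k)"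
  have "f (k + ord (2 ^ n) g) = f k" for k
  proof -
    have "[w * g ^ k * g ^ ord (2 ^ n) g = w * g ^ k * 1] (mod 2 ^ n)"
      by (intro cong_mult cong_refl cong_power_ord_int) (use assms(1) in simp_all)
    thus ?thesis unfolding f_def
      by (intro exp_two_power_cong) (simp add: power_add mult.assoc)
  qed
  hence "S = (\<Sum>k = 1..ord (2 ^ n) g. f (k + j))"
    unfolding S_def by (rule sum_periodic_shift [symmetric])
  also have "f (k + j) = - f k" for k
    unfolding f_def
  proof (rule exp_two_power_half)
    \<comment> \<open>The factor 2^d of w turns half the modulus 2^m into half the modulus 2^n,
      leaving the odd cofactor \<open>w' * g ^ k * q\<close>.\<close>
    have "(2 :: int) ^ (n - 1) = 2 ^ d * 2 ^ (m - 1)"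
      using m by (simp flip: power_add)
    thus "w * g ^ (k + j) = w * g ^ k + 2 ^ (n - 1) * (w' * g ^ k * q)"
      by (simp add: power_add j(2) w'(1) algebra_simps)
    show "odd (w' * g ^ k * q)" using w'(2) assms(1) j(1) by simp
    show "n \<ge> 1" using m by simp
  qed
  hence "(\<Sum>k = 1..ord (2 ^ n) g. f (k + j)) = - S"
    by (simp add: S_def sum_negf)
  finally have "S = 0" by simp
  thus ?thesis by (simp add: S_def f_def mult.assoc)
qed

end
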